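(* Let $n\ge2$ and let $\mathcal{F}_h(n)$ be the family of systems $\dot x=-y+F_n(x,y)$, $\dot y=x+G_n(x,y)$, where $F_n,G_n$ are real homogeneous polynomials of degree $n$ whose coefficients $(f,g)$ are the parameters. Let $V_{n+1}=\sum_{i+j=n+1}v_{i,j}x^iy^j$ be the degree-$(n+1)$ term of the Lyapunov function, $L_1,L_2,\dots$ the Lyapunov constants, and $\mathfrak{B}(\mathcal{F}_h(n))=\langle L_1,L_2,\dots\rangle\subseteq\mathbb{R}[f,g]$ the Bautin ideal. If $n$ is even, the ideal generated by the coefficients of $V_{n+1}$ contains the Bautin ideal: $$\mathfrak{B}(\mathcal{F}_h(n))=\langle L_1,L_2,\dots\rangle\subseteq\langle v_{n+1,0},v_{n,1},\dots,v_{0,n+1}\rangle,$$ and $V_{n+1}=0$ gives a collection of center conditions (that is, if all coefficients of $V_{n+1}$ vanish then $L_j=0$ for all $j\ge1$). If $n$ is odd, $$\mathfrak{B}(\mathcal{F}_h(n))=\langle L_1,L_2,\dots\rangle\subseteq\langle L_{(n-1)/2},v_{n+1,0},v_{n,1},\dots,v_{0,n+1}\rangle,$$ and $L_{(n-1)/2}=0$ together with $V_{n+1}=0$ provide a collection of center conditions (that is, they imply $L_j=0$ for all $j\ge1$).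
   Context: Parameters: $F_n(x,y)=\sum_{i+j=n}f_{i,j}x^iy^j$, $G_n(x,y)=\sum_{i+j=n}g_{i,j}x^iy^j$ with real coefficients; $(f,g)$ is the collection of these $2(n+1)$ coefficients, regarded as indeterminates in $\mathbb{R}[f,g]$. Lyapunov function and Lyapunov constants: one considers a formal power series $V=V_2+V_3+V_4+\cdots$ with $V_2=\tfrac12(x^2+y^2)$ and $V_k=\sum_{i+j=k}v_{i,j}x^iy^j$ for $k\ge3$, and constants $L_1,L_2,\dots$, satisfying the Lyapunov formula (as formal power series in $x,y$) $$\dot V=\frac{\partial V}{\partial x}\,(-y+F_n)+\frac{\partial V}{\partial y}\,(x+G_n)=L_1(x^2+y^2)^2+L_2(x^2+y^2)^3+L_3(x^2+y^2)^4+\cdots .$$ Matching terms degree by degree gives linear systems for the $v_{i,j}$ and $L_j$. They are made uniquely solvable by the normalization: for $k=4m$ set $v_{2m,2m}=0$, and for $k=4m+2\ge6$ set $v_{2m,2m+2}=0$. The resulting $v_{i,j}$ and $L_j$ are polynomials in $(f,g)$. The $L_j$ are called Lyapunov constants. A center condition is a finite set of algebraic relations in the parameters $(f,g)$ ensuring that $L_j=0$ for all $j\in\mathbb{Z}^+$. *)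

theory Defs
  imports
    "HOL-Library.Poly_Mapping"
    "HOL-Computational_Algebra.Formal_Power_Series"
    "HOL-Algebra.Ideal"
begin

unbundle fps_syntax

datatype param = PF nat nat | PG nat nat

type_synonym param_poly = "(param \<Rightarrow>\<^sub>0 nat) \<Rightarrow>\<^sub>0 real"

definition params :: "nat \<Rightarrow> param set" where
  "params n = {PF i j | i j. i + j = n} \<union> {PG i j | i j. i + j = n}"

text \<open>The type \<^typ>\<open>param_poly\<close> has infinitely many indeterminates; the ring of polynomials in
  the \<open>2 (n + 1)\<close> coefficients of a degree-\<open>n\<close> system is a subring of it, given as a ring object
  so that ideals are formed inside this subring.\<close>

definition param_ring :: "nat \<Rightarrow> param_poly ring" where
  "param_ring n = \<lparr>carrier = {p. \<forall>m \<in> Poly_Mapping.keys p. Poly_Mapping.keys m \<subseteq> params n},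
     mult = (*), one = 1, zero = 0, add = (+)\<rparr>"

lemma cring_param_ring: "cring (param_ring n)"
proof (rule cringI)
  show "abelian_group (param_ring n)"
  proof (rule abelian_groupI)
    fix p assume p: "p \<in> carrier (param_ring n)"
    then have "- p \<in> carrier (param_ring n)"
      by (simp add: param_ring_def in_keys_iff)
    then show "\<exists>q \<in> carrier (param_ring n). q \<oplus>\<^bsub>param_ring n\<^esub> p = \<zero>\<^bsub>param_ring n\<^esub>"
      by (intro bexI[of _ "- p"]) (simp_all add: param_ring_def)
  next
    fix p q assume "p \<in> carrier (param_ring n)" "q \<in> carrier (param_ring n)"
    then show "p \<oplus>\<^bsub>param_ring n\<^esub> q \<in> carrier (param_ring n)"
      using Poly_Mapping.keys_add[of p q] by (auto simp: param_ring_def)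
  qed (simp_all add: param_ring_def algebra_simps)
  show "comm_monoid (param_ring n)"
  proof (rule comm_monoidI)
    fix p q assume pq: "p \<in> carrier (param_ring n)" "q \<in> carrier (param_ring n)"
    have "Poly_Mapping.keys m \<subseteq> params n" if m: "m \<in> Poly_Mapping.keys (p * q)" for m
    proof -
      obtain a b where "m = a + b" "a \<in> Poly_Mapping.keys p" "b \<in> Poly_Mapping.keys q"
        using m Poly_Mapping.keys_mult[of p q] by blast
      then show ?thesis using pq Poly_Mapping.keys_add[of a b]
        unfolding param_ring_def by fastforce
    qed
    then show "p \<otimes>\<^bsub>param_ring n\<^esub> q \<in> carrier (param_ring n)"
      by (simp add: param_ring_def)
  qed (simp_all add: param_ring_def algebra_simps)
qed (simp add: param_ring_def algebra_simps)

definition rconst :: "real \<Rightarrow> param_poly" where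
  "rconst c = Poly_Mapping.single 0 c"

definition pvar :: "param \<Rightarrow> param_poly" where
  "pvar z = Poly_Mapping.single (Poly_Mapping.single z 1) 1"

definition param_eval :: "(param \<Rightarrow> real) \<Rightarrow> param_poly \<Rightarrow> real" where
  "param_eval a p = (\<Sum>m \<in> Poly_Mapping.keys p. Poly_Mapping.lookup p m *
     (\<Prod>z \<in> Poly_Mapping.keys m. a z ^ Poly_Mapping.lookup m z))"

text \<open>Formal power series in \<open>x\<close> and \<open>y\<close>: the outer variable is \<open>x\<close>, the inner one is \<open>y\<close>, so
  \<open>S $ i $ j\<close> is the coefficient of \<open>x\<^sup>i y\<^sup>j\<close> in \<open>S\<close>.\<close>

type_synonym series2 = "param_poly fps fps"

definition xvar :: series2 where "xvar = fps_X"

definition yvar :: series2 where "yvar = fps_const fps_X"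

definition scal :: "param_poly \<Rightarrow> series2" where "scal c = fps_const (fps_const c)"

definition dx :: "series2 \<Rightarrow> series2" where "dx S = fps_deriv S"

definition dy :: "series2 \<Rightarrow> series2" where "dy S = Abs_fps (\<lambda>i. fps_deriv (S $ i))"

definition form_F :: "nat \<Rightarrow> series2" where
  "form_F n = (\<Sum>(i, j) \<in> {(i, j). i + j = n}. scal (pvar (PF i j)) * xvar ^ i * yvar ^ j)"

definition form_G :: "nat \<Rightarrow> series2" where
  "form_G n = (\<Sum>(i, j) \<in> {(i, j). i + j = n}. scal (pvar (PG i j)) * xvar ^ i * yvar ^ j)"

text \<open>The formal sum \<open>L\<^sub>1 (x\<^sup>2 + y\<^sup>2)\<^sup>2 + L\<^sub>2 (x\<^sup>2 + y\<^sup>2)\<^sup>3 + \<dots>\<close>, taken coefficientwise. The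
  coefficient of \<open>x\<^sup>i y\<^sup>j\<close> in the \<open>m\<close>-th summand vanishes unless \<open>i + j = 2 (m + 1)\<close>, so the sum may
  be cut off at \<open>m = i + j\<close>. The value \<open>L 0\<close> plays no role.\<close>

definition lyapunov_rhs :: "(nat \<Rightarrow> param_poly) \<Rightarrow> series2" where
  "lyapunov_rhs L = Abs_fps (\<lambda>i. Abs_fps (\<lambda>j.
     \<Sum>m = 1..i + j. (scal (L m) * (xvar\<^sup>2 + yvar\<^sup>2) ^ (m + 1)) $ i $ j))"

definition lyapunov_function :: "(nat \<Rightarrow> nat \<Rightarrow> param_poly) \<Rightarrow> series2" where
  "lyapunov_function v = Abs_fps (\<lambda>i. Abs_fps (\<lambda>j. v i j))"

text \<open>\<open>v i j\<close> is the coefficient of \<open>x\<^sup>i y\<^sup>j\<close> in the Lyapunov function and \<open>L j\<close> (for \<open>j \<ge> 1\<close>) the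
  \<open>j\<close>-th Lyapunov constant, both as polynomials in the parameters. The conditions determine all
  \<open>v i j\<close> and all \<open>L j\<close> with \<open>j \<ge> 1\<close>.\<close>

definition is_lyapunov :: "nat \<Rightarrow> (nat \<Rightarrow> nat \<Rightarrow> param_poly) \<Rightarrow> (nat \<Rightarrow> param_poly) \<Rightarrow> bool" where
  "is_lyapunov n v L \<longleftrightarrow>
     (\<forall>i j. v i j \<in> carrier (param_ring n)) \<and>
     (\<forall>j \<ge> 1. L j \<in> carrier (param_ring n)) \<and>
     (\<forall>i j. i + j < 2 \<longrightarrow> v i j = 0) \<and>
     v 2 0 = rconst (1/2) \<and> v 1 1 = 0 \<and> v 0 2 = rconst (1/2) \<and>
     (\<forall>m \<ge> 1. v (2 * m) (2 * m) = 0) \<and>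
     (\<forall>m \<ge> 1. v (2 * m) (2 * m + 2) = 0) \<and>
     dx (lyapunov_function v) * (- yvar + form_F n) + dy (lyapunov_function v) * (xvar + form_G n)
       = lyapunov_rhs L"

definition V_coeffs :: "nat \<Rightarrow> (nat \<Rightarrow> nat \<Rightarrow> param_poly) \<Rightarrow> param_poly set" where
  "V_coeffs k v = {v i j | i j. i + j = k}"

definition bautin_ideal :: "nat \<Rightarrow> (nat \<Rightarrow> param_poly) \<Rightarrow> param_poly set" where
  "bautin_ideal n L = Idl\<^bsub>param_ring n\<^esub> {L j | j. j \<ge> 1}"

text \<open>The algebraic relations are \<open>p = 0\<close> for \<open>p \<in> C\<close>.\<close>

definition center_condition :: "nat \<Rightarrow> (nat \<Rightarrow> param_poly) \<Rightarrow> param_poly set \<Rightarrow> bool" where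
  "center_condition n L C \<longleftrightarrow> finite C \<and> C \<subseteq> carrier (param_ring n) \<and>
     (\<forall>a. (\<forall>p \<in> C. param_eval a p = 0) \<longrightarrow> (\<forall>j \<ge> 1. param_eval a (L j) = 0))"

end

theory Submission
  imports Defs
begin

text \<open>The rotation \<open>x \<partial>/\<partial>y - y \<partial>/\<partial>x\<close> acts on the forms of degree \<open>k\<close>; its cokernel is spanned by
  \<open>(x\<^sup>2 + y\<^sup>2)\<^bsup>k/2\<^esup>\<close> for \<open>k\<close> even and vanishes for \<open>k\<close> odd, and on forms obeying the normalization it
  is injective. Hence the degree-\<open>k\<close> part of the Lyapunov formula, read modulo an ideal \<open>I\<close>, forces
  \<open>V\<^sub>k\<close> and \<open>L\<^bsub>k/2-1\<^esub>\<close> into \<open>I\<close> whenever the nonlinear terms \<open>F \<partial>V/\<partial>x + G \<partial>V/\<partial>y\<close> are in \<open>I\<close> in that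
  degree. These come from \<open>V\<close> in degree \<open>k + 1 - n\<close>, so induction on \<open>k\<close> applies except for
  \<open>k = n + 1\<close>, where \<open>V\<^sub>2\<close> enters; there \<open>V\<^sub>k\<close> and \<open>L\<^bsub>k/2-1\<^esub>\<close> are in \<open>I\<close> by assumption. The center
  conditions are the case where \<open>I\<close> is the kernel of an evaluation.\<close>

subsection \<open>Solving the rotation equation modulo a subspace\<close>

lemma (in vector_space) subspace_scale_cancel:
  assumes "subspace I" and "c \<noteq> 0" and "scale c x \<in> I"
  shows "x \<in> I"
  using subspace_scale[OF assms(1,3), of "inverse c"] assms(2) by simp

text \<open>Here \<open>w i\<close> stands for the coefficient of \<open>x^i y^(k-i)\<close> in a
  form of degree \<open>k\<close>, \<open>l\<close> for a Lyapunov constant and \<open>c i\<close>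
  for a coefficient of \<open>(x^2 + y^2)^(k/2)\<close>. Row \<open>i\<close> of \<open>eq\<close>
  is the coefficient of \<open>x^i y^(k-i)\<close> in the rotated form minus the right-hand side;
  membership in \<open>I\<close> expresses congruence modulo \<open>I\<close>.\<close>

context
  fixes scale :: "real \<Rightarrow> 'b::ab_group_add \<Rightarrow> 'b" and I :: "'b set"
    and k :: nat and w :: "nat \<Rightarrow> 'b" and l :: 'b and c :: "nat \<Rightarrow> real"
  assumes vs: "vector_space scale" and sub: "module.subspace scale I"
    and eq: "\<And>i. i \<le> k \<Longrightarrow>
      (if i = 0 then 0 else scale (real (k - i + 1)) (w (i - 1)))
      - (if i = k then 0 else scale (real (i + 1)) (w (i + 1))) - scale (c i) l \<in> I"
begin

interpretation vector_space scale by (rule vs)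

lemma rotation_step_up:
  assumes "i < k" and "i > 0 \<Longrightarrow> w (i - 1) \<in> I" and "scale (c i) l \<in> I"
  shows "w (i + 1) \<in> I"
proof -
  let ?a = "if i = 0 then 0 else scale (real (k - i + 1)) (w (i - 1))"
  have "?a \<in> I" using assms(2) sub by (auto simp: subspace_0 intro: subspace_scale)
  moreover have "?a - scale (real (i + 1)) (w (i + 1)) - scale (c i) l \<in> I"
    using eq[of i] assms(1) by simp
  ultimately have "?a - (?a - scale (real (i + 1)) (w (i + 1)) - scale (c i) l) - scale (c i) l \<in> I"
    using assms(3) sub by (blast intro: subspace_diff)
  then have "scale (real (i + 1)) (w (i + 1)) \<in> I" by (simp only: algebra_simps) simp
  then show ?thesis by (rule subspace_scale_cancel[OF sub, rotated]) simp
qed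

lemma rotation_step_down:
  assumes "0 < i" and "i \<le> k" and "i < k \<Longrightarrow> w (i + 1) \<in> I" and "scale (c i) l \<in> I"
  shows "w (i - 1) \<in> I"
proof -
  let ?b = "if i = k then 0 else scale (real (i + 1)) (w (i + 1))"
  have "?b \<in> I" using assms(2,3) sub by (auto simp: subspace_0 intro!: subspace_scale)
  moreover have "scale (real (k - i + 1)) (w (i - 1)) - ?b - scale (c i) l \<in> I"
    using eq[of i] assms(1,2) by simp
  ultimately have "(scale (real (k - i + 1)) (w (i - 1)) - ?b - scale (c i) l) + ?b + scale (c i) l \<in> I"
    using assms(4) sub by (blast intro: subspace_add)
  then have "scale (real (k - i + 1)) (w (i - 1)) \<in> I" by simp
  then show ?thesis by (rule subspace_scale_cancel[OF sub, rotated]) simp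
qed

lemma rotation_up:
  assumes "w p \<in> I" and "p + 2 * s \<le> k" and "\<And>i. odd (i + p) \<Longrightarrow> scale (c i) l \<in> I"
  shows "w (p + 2 * s) \<in> I"
  using assms(2)
proof (induction s)
  case (Suc s)
  then show ?case
    using rotation_step_up[of "p + 2 * s + 1"] assms(3)[of "p + 2 * s + 1"] by simp
qed (use assms(1) in simp)

lemma rotation_down:
  assumes "w p \<in> I" and "2 * s \<le> p" and "p \<le> k" and "\<And>i. odd (i + p) \<Longrightarrow> scale (c i) l \<in> I"
  shows "w (p - 2 * s) \<in> I"
  using assms(2)
proof (induction s)
  case (Suc s)
  then have "p - 2 * s - 1 + 1 = p - 2 * s" "p - 2 * s - 1 - 1 = p - 2 * Suc s"
    "odd (p - 2 * s - 1 + p)" "0 < p - 2 * s - 1" "p - 2 * s - 1 \<le> k"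
    using assms(3) by (auto)
  then show ?case
    using rotation_step_down[of "p - 2 * s - 1"] assms(4)[of "p - 2 * s - 1"] Suc by simp
qed (use assms(1) in simp)

text \<open>Row \<open>i\<close> links only \<open>w (i - 1)\<close> and \<open>w (i + 1)\<close>,
  so the system splits by parity and one entry determines its whole class modulo \<open>I\<close>.
  Only rows of the parity opposite to \<open>p\<close> are used.\<close>

lemma rotation_same_parity:
  assumes "w p \<in> I" and "even (p + i)" and "p \<le> k" and "i \<le> k"
    and "\<And>i. odd (i + p) \<Longrightarrow> scale (c i) l \<in> I"
  shows "w i \<in> I"
proof (cases "p \<le> i")
  case True
  then obtain s where "i = p + 2 * s" using assms(2)
    by (metis add.commute dvd_def even_diff_nat le_add_diff_inverse not_less)
  then show ?thesis using rotation_up[of p s] assms by simp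
next
  case False
  then obtain s where "p = i + 2 * s" using assms(2)
    by (metis dvd_def even_diff_nat le_add_diff_inverse nat_le_linear)
  then show ?thesis using rotation_down[of p s] assms by simp
qed

text \<open>The end rows \<open>0\<close> and \<open>k\<close> have a single unknown each,
  \<open>w 1\<close> and \<open>w (k - 1)\<close>. For odd \<open>k\<close> these indices differ in
  parity, so both classes are reached.\<close>

lemma rotation_odd_degree:
  assumes "odd k" and "\<And>i. c i = 0" and "i \<le> k"
  shows "w i \<in> I"
proof -
  have z: "scale (c i) l \<in> I" for i using sub by (simp add: assms(2) subspace_0)
  have "w 1 \<in> I" using rotation_step_up[of 0] z assms(1) by (cases k) auto
  moreover have "w (k - 1) \<in> I" using rotation_step_down[of k] z assms(1) by (cases k) auto
  ultimately show ?thesis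
    using rotation_same_parity[of 1 i] rotation_same_parity[of "k - 1" i] z assms
    by (cases "even i") (auto elim: oddE)
qed

text \<open>Starting at \<open>w 1 \<equiv> - c 0 l\<close>, the even equations give \<open>w (2 s + 1) \<equiv> - d l\<close> with \<open>d > 0\<close>, while
  the last one reads \<open>w (k - 1) \<equiv> c k l\<close>; so a positive multiple of \<open>l\<close> lies in the subspace.\<close>

lemma rotation_even_degree_const:
  assumes "even k" and "k > 0" and "c 0 > 0" and "\<And>i. c i \<ge> 0"
  shows "l \<in> I"
proof -
  have ex: "\<exists>d > 0. w (2 * s + 1) + scale d l \<in> I" if "2 * s < k" for s
    using that
  proof (induction s)
    case 0
    then have "- w 1 - scale (c 0) l \<in> I" using eq[of 0] by simp
    then have "- (- w 1 - scale (c 0) l) \<in> I" using sub by (rule subspace_neg[rotated])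
    then show ?case using assms(3) by (auto simp: algebra_simps)
  next
    case (Suc s)
    then obtain d where d: "d > 0" "w (2 * s + 1) + scale d l \<in> I" by auto
    define q where "q = real (k - 2 * Suc s + 1)"
    define e where "e = real (2 * Suc s + 1)"
    have e: "e > 0" by (simp add: e_def)
    have "scale q (w (2 * s + 1)) - scale e (w (2 * Suc s + 1)) - scale (c (2 * Suc s)) l \<in> I"
      using eq[of "2 * Suc s"] Suc.prems by (simp add: q_def e_def)
    moreover have "scale q (w (2 * s + 1) + scale d l) \<in> I" using d sub by (blast intro: subspace_scale)
    \<comment> \<open>Subtracting the row from \<open>q\<close> times the induction hypothesis
      eliminates \<open>w (2 * s + 1)\<close>; division by \<open>e\<close> normalizes the next
      entry.\<close>
    ultimately have "scale (inverse e) (scale q (w (2 * s + 1) + scale d l) - (scale q (w (2 * s + 1))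
        - scale e (w (2 * Suc s + 1)) - scale (c (2 * Suc s)) l)) \<in> I"
      using sub by (blast intro: subspace_scale subspace_diff)
    then have "w (2 * Suc s + 1) + scale (inverse e * (q * d + c (2 * Suc s))) l \<in> I"
      using e by (simp add: algebra_simps del: mult_Suc_right mult_Suc)
    moreover have "inverse e * (q * d + c (2 * Suc s)) > 0"
      using d assms(4)[of "2 * Suc s"] e by (simp add: q_def add_pos_nonneg)
    ultimately show ?case by blast
  qed
  define s where "s = (k - 2) div 2"
  have s: "2 * s + 1 = k - 1" "2 * s < k" using assms(1,2) by (auto simp: s_def)
  obtain d where d: "d > 0" "w (k - 1) + scale d l \<in> I" using ex[OF s(2)] unfolding s(1) by auto
  have "w (k - 1) - scale (c k) l \<in> I" using eq[of k] assms(2) by simp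
  from subspace_diff[OF sub d(2) this] have "scale (d + c k) l \<in> I" by (simp add: algebra_simps)
  then show ?thesis by (rule subspace_scale_cancel[OF sub, rotated]) (use d assms(4)[of k] in simp)
qed

text \<open>Both end rows now concern odd indices, which leaves the even entries free up to the
  kernel of the rotation, spanned by \<open>(x^2 + y^2)^(k/2)\<close>. The known even entry
  \<open>w p\<close> removes this freedom.\<close>

lemma rotation_even_degree:
  assumes "even k" and "k > 0" and "c 0 > 0" and "\<And>i. c i \<ge> 0" and "\<And>i. odd i \<Longrightarrow> c i = 0"
    and "even p" and "p \<le> k" and "w p \<in> I" and "i \<le> k"
  shows "w i \<in> I"
proof -
  have z: "scale (c i) l \<in> I" for i
    using rotation_even_degree_const[OF assms(1-4)] sub by (blast intro: subspace_scale)
  have "w 1 \<in> I" using rotation_step_up[of 0] z assms(2) by simp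
  then show ?thesis
    using rotation_same_parity[of 1 i] rotation_same_parity[of p i] z assms(2,6-9)
    by (cases "even i") auto
qed

end

subsection \<open>Evaluation and ideals of the parameter ring\<close>

lemma poly_mapping_eq_sum_single:
  "p = (\<Sum>m \<in> Poly_Mapping.keys p. Poly_Mapping.single m (Poly_Mapping.lookup p m))"
  by (rule poly_mapping_eqI)
    (auto simp: lookup_sum lookup_single when_def in_keys_iff)

text \<open>Cancellation can shrink the support of a sum, so evaluations are compared over a common
  finite set of monomials.\<close>

lemma param_eval_superset:
  assumes "finite S" and "Poly_Mapping.keys p \<subseteq> S"
  shows "param_eval a p = (\<Sum>m \<in> S. Poly_Mapping.lookup p m *
     (\<Prod>z \<in> Poly_Mapping.keys m. a z ^ Poly_Mapping.lookup m z))"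
  unfolding param_eval_def by (rule sum.mono_neutral_left) (use assms in \<open>auto simp: in_keys_iff\<close>)

lemma param_eval_zero [simp]: "param_eval a 0 = 0"
  by (simp add: param_eval_def)

lemma param_eval_add: "param_eval a (p + q) = param_eval a p + param_eval a q"
proof -
  let ?S = "Poly_Mapping.keys p \<union> Poly_Mapping.keys q"
  have "Poly_Mapping.keys (p + q) \<subseteq> ?S" by (rule Poly_Mapping.keys_add)
  then show ?thesis
    by (simp add: param_eval_superset[of ?S] lookup_add sum.distrib algebra_simps)
qed

lemma param_eval_sum: "param_eval a (\<Sum>x \<in> A. f x) = (\<Sum>x \<in> A. param_eval a (f x))"
  by (induction A rule: infinite_finite_induct) (simp_all add: param_eval_add)

lemma param_eval_single:
  "param_eval a (Poly_Mapping.single m c) =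
    c * (\<Prod>z \<in> Poly_Mapping.keys m. a z ^ Poly_Mapping.lookup m z)"
  by (cases "c = 0") (simp_all add: param_eval_def)

text \<open>Extending all three products to the union of the supports adds only factors
  \<open>a z ^ 0\<close>.\<close>

lemma prod_power_lookup_add:
  fixes a :: "'z \<Rightarrow> 'r::comm_semiring_1"
  shows "(\<Prod>z \<in> Poly_Mapping.keys (m + m'). a z ^ Poly_Mapping.lookup (m + m') z) =
    (\<Prod>z \<in> Poly_Mapping.keys m. a z ^ Poly_Mapping.lookup m z) *
    (\<Prod>z \<in> Poly_Mapping.keys m'. a z ^ Poly_Mapping.lookup m' z)"
proof -
  let ?S = "Poly_Mapping.keys m \<union> Poly_Mapping.keys m'"
  have ext: "(\<Prod>z \<in> Poly_Mapping.keys u. a z ^ Poly_Mapping.lookup u z) =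
      (\<Prod>z \<in> ?S. a z ^ Poly_Mapping.lookup u z)" if "Poly_Mapping.keys u \<subseteq> ?S" for u
    by (rule prod.mono_neutral_left) (use that in \<open>auto simp: in_keys_iff\<close>)
  show ?thesis
    using ext[of m] ext[of m'] ext[of "m + m'"] Poly_Mapping.keys_add[of m m']
    by (simp add: lookup_add power_add prod.distrib)
qed

lemma param_eval_mult: "param_eval a (p * q) = param_eval a p * param_eval a q"
proof -
  have "p * q = (\<Sum>m \<in> Poly_Mapping.keys p. \<Sum>m' \<in> Poly_Mapping.keys q.
      Poly_Mapping.single (m + m') (Poly_Mapping.lookup p m * Poly_Mapping.lookup q m'))"
    by (subst poly_mapping_eq_sum_single[of p], subst poly_mapping_eq_sum_single[of q])
      (simp add: sum_product mult_single)
  then have "param_eval a (p * q) = (\<Sum>m \<in> Poly_Mapping.keys p. \<Sum>m' \<in> Poly_Mapping.keys q.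
      (Poly_Mapping.lookup p m * (\<Prod>z \<in> Poly_Mapping.keys m. a z ^ Poly_Mapping.lookup m z)) *
      (Poly_Mapping.lookup q m' * (\<Prod>z \<in> Poly_Mapping.keys m'. a z ^ Poly_Mapping.lookup m' z)))"
    by (simp add: param_eval_sum param_eval_single prod_power_lookup_add mult_ac)
  then show ?thesis by (simp add: param_eval_def sum_product)
qed

text \<open>Evaluation respects sums and products. Membership of \<open>L j\<close> in this ideal is
  its vanishing at \<open>a\<close>, which turns center conditions into ideal membership.\<close>

lemma ideal_param_eval_kernel:
  "ideal {p \<in> carrier (param_ring n). param_eval a p = 0} (param_ring n)"
proof (rule idealI)
  interpret cring "param_ring n" by (rule cring_param_ring)
  show "ring (param_ring n)" ..
  let ?K = "{p \<in> carrier (param_ring n). param_eval a p = 0}"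
  have add: "x \<oplus>\<^bsub>param_ring n\<^esub> y = x + y" and mult: "x \<otimes>\<^bsub>param_ring n\<^esub> y = x * y"
    and zero: "\<zero>\<^bsub>param_ring n\<^esub> = 0" for x y
    by (simp_all add: param_ring_def)
  show "subgroup ?K (add_monoid (param_ring n))"
  proof (rule subgroup.intro)
    fix x assume x: "x \<in> ?K"
    have "x + \<ominus>\<^bsub>param_ring n\<^esub> x = 0"
      using r_neg[of x] x by (simp add: add zero)
    then have "param_eval a x + param_eval a (\<ominus>\<^bsub>param_ring n\<^esub> x) = 0"
      by (metis param_eval_add param_eval_zero)
    then show "inv\<^bsub>add_monoid (param_ring n)\<^esub> x \<in> ?K"
      using x a_inv_closed[of x] by (simp add: a_inv_def)
  next
    fix x y assume "x \<in> ?K" "y \<in> ?K"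
    then show "x \<otimes>\<^bsub>add_monoid (param_ring n)\<^esub> y \<in> ?K"
      using a_closed[of x y] by (simp add: add param_eval_add)
  next
    show "\<one>\<^bsub>add_monoid (param_ring n)\<^esub> \<in> ?K" using zero_closed by (simp add: zero)
  qed auto
  fix p q assume "p \<in> ?K" "q \<in> carrier (param_ring n)"
  then show "q \<otimes>\<^bsub>param_ring n\<^esub> p \<in> ?K" "p \<otimes>\<^bsub>param_ring n\<^esub> q \<in> ?K"
    using m_closed[of p q] m_closed[of q p] by (simp_all add: mult param_eval_mult)
qed

lemma vector_space_rconst: "vector_space (\<lambda>c p. rconst c * p)"
  by unfold_locales
    (simp_all add: rconst_def algebra_simps single_add mult_single flip: mult.assoc)

lemma rconst_of_nat: "rconst (of_nat k) = of_nat k"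
  by (induction k) (simp_all add: rconst_def single_add single_one)

lemma rconst_in_carrier: "rconst c \<in> carrier (param_ring n)"
  by (auto simp: rconst_def param_ring_def)

lemma pvar_in_carrier: "z \<in> params n \<Longrightarrow> pvar z \<in> carrier (param_ring n)"
  by (auto simp: pvar_def param_ring_def)

text \<open>Real constants belong to the ring, so an ideal absorbs them; this makes the rotation
  lemmas applicable to ideals.\<close>

lemma subspace_ideal:
  assumes "ideal I (param_ring n)"
  shows "module.subspace (\<lambda>c p. rconst c * p) I"
proof -
  interpret V: vector_space "\<lambda>c p. rconst c * p" by (rule vector_space_rconst)
  interpret ideal I "param_ring n" by (rule assms)
  show ?thesis
    using additive_subgroup.zero_closed[OF is_additive_subgroup]
      additive_subgroup.a_closed[OF is_additive_subgroup] I_l_closed[OF _ rconst_in_carrier]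
    by (intro V.subspaceI) (simp_all add: param_ring_def)
qed

subsection \<open>The Lyapunov formula degree by degree\<close>

lemma form_nth:
  assumes "finite A"
  shows "(S * (\<Sum>(i, j) \<in> A. scal (p i j) * xvar ^ i * yvar ^ j)) $ a $ b =
    (\<Sum>(i, j) \<in> A. if i \<le> a \<and> j \<le> b then p i j * S $ (a - i) $ (b - j) else 0)"
proof -
  have "(S * (scal c * xvar ^ i * yvar ^ j)) $ a $ b =
     (if i \<le> a \<and> j \<le> b then c * S $ (a - i) $ (b - j) else 0)" for c i j
  proof -
    have "S * (scal c * xvar ^ i * yvar ^ j) =
        fps_const (fps_const c) * ((S * fps_X ^ i) * fps_const (fps_X ^ j))"
      by (simp add: scal_def xvar_def yvar_def fps_const_power mult_ac)
    then show ?thesis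
      by (simp add: fps_X_power_mult_right_nth)
  qed
  then show ?thesis
    by (simp add: sum_distrib_left fps_sum_nth case_prod_unfold)
qed

lemma sum_squares_power_nth:
  "((xvar\<^sup>2 + yvar\<^sup>2) ^ N) $ a $ b =
    (if even a \<and> even b \<and> a + b = 2 * N then of_nat (N choose (a div 2)) else 0)"
proof -
  \<comment> \<open>The nested conditional isolates \<open>k = a div 2\<close>, so that the binomial
    sum collapses to one term.\<close>
  have *: "(of_nat (N choose k) * (xvar\<^sup>2) ^ k * (yvar\<^sup>2) ^ (N - k)) $ a $ b =
     (if k = a div 2 then if even a \<and> b = 2 * (N - k) then of_nat (N choose k) else 0 else 0)" for k
  proof -
    have "of_nat (N choose k) * (xvar\<^sup>2) ^ k * (yvar\<^sup>2) ^ (N - k) =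
       fps_const (fps_const (of_nat (N choose k))) * (fps_X ^ (2 * k) * fps_const (fps_X ^ (2 * (N - k))))"
      by (simp add: xvar_def yvar_def fps_const_power fps_of_nat mult_ac flip: power_mult)
    then show ?thesis by auto
  qed
  have "((xvar\<^sup>2 + yvar\<^sup>2) ^ N) $ a $ b =
    (\<Sum>k\<le>N. if k = a div 2 then if even a \<and> b = 2 * (N - k) then of_nat (N choose k) else 0 else 0)"
    by (simp only: binomial_ring fps_sum_nth *)
  also have "\<dots> = (if even a \<and> even b \<and> a + b = 2 * N then of_nat (N choose (a div 2)) else 0)"
    by (auto elim!: evenE)
  finally show ?thesis .
qed

text \<open>By homogeneity only the summand \<open>m = (a + b) div 2 - 1\<close> contributes. From
  degree 3 on, even degrees are at least 4, so this index lies in the range starting at 1.\<close>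

lemma lyapunov_rhs_nth:
  assumes "a + b \<ge> 3"
  shows "lyapunov_rhs L $ a $ b =
    (if even a \<and> even b then of_nat (((a + b) div 2) choose (a div 2)) * L ((a + b) div 2 - 1) else 0)"
proof -
  let ?c = "if even a \<and> even b then of_nat (((a + b) div 2) choose (a div 2)) * L ((a + b) div 2 - 1) else 0"
  have "(scal (L m) * (xvar\<^sup>2 + yvar\<^sup>2) ^ (m + 1)) $ a $ b = (if m = (a + b) div 2 - 1 then ?c else 0)"
    if "m \<ge> 1" for m
  proof -
    have "even a \<and> even b \<and> a + b = 2 * (m + 1) \<longleftrightarrow> even a \<and> even b \<and> m = (a + b) div 2 - 1"
      using that by (auto elim!: evenE)
    moreover have "m + 1 = (a + b) div 2" if "m = (a + b) div 2 - 1" "even a" "even b"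
      using that assms by (auto elim!: evenE)
    ultimately show ?thesis
      by (simp add: scal_def sum_squares_power_nth mult.commute del: power_Suc)
  qed
  then have "lyapunov_rhs L $ a $ b = (\<Sum>m = 1..a + b. if m = (a + b) div 2 - 1 then ?c else 0)"
    by (simp add: lyapunov_rhs_def)
  also have "\<dots> = ?c" using assms by (auto elim!: evenE)
  finally show ?thesis .
qed

lemma lyapunov_formula_nth:
  assumes "is_lyapunov n v L" and "a + b \<ge> 3"
  shows "(if a = 0 then 0 else of_nat (b + 1) * v (a - 1) (b + 1))
    - (if b = 0 then 0 else of_nat (a + 1) * v (a + 1) (b - 1))
    + (\<Sum>(i, j) \<in> {(i, j). i + j = n}. if i \<le> a \<and> j \<le> b
        then pvar (PF i j) * (of_nat (a - i + 1) * v (a - i + 1) (b - j)) else 0)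
    + (\<Sum>(i, j) \<in> {(i, j). i + j = n}. if i \<le> a \<and> j \<le> b
        then pvar (PG i j) * (of_nat (b - j + 1) * v (a - i) (b - j + 1)) else 0)
    = (if even a \<and> even b then of_nat (((a + b) div 2) choose (a div 2)) * L ((a + b) div 2 - 1) else 0)"
proof -
  have fin: "finite {(i, j). i + j = n}"
    by (rule finite_subset[of _ "{..n} \<times> {..n}"]) auto
  have dx: "dx (lyapunov_function v) $ i $ j = of_nat (i + 1) * v (i + 1) j" for i j
  proof -
    have "dx (lyapunov_function v) $ i = fps_const (of_nat (i + 1)) * lyapunov_function v $ (i + 1)"
      by (simp add: dx_def fps_of_nat del: of_nat_Suc of_nat_add)
    then show ?thesis by (simp add: lyapunov_function_def)
  qed
  have dy: "dy (lyapunov_function v) $ i $ j = of_nat (j + 1) * v i (j + 1)" for i j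
    by (simp add: dy_def lyapunov_function_def)
  have x: "(S * xvar) $ a $ b = (if a = 0 then 0 else S $ (a - 1) $ b)" for S
    by (simp add: xvar_def)
  have y: "(S * yvar) $ a $ b = (if b = 0 then 0 else S $ a $ (b - 1))" for S
    by (simp add: yvar_def)
  have "(dx (lyapunov_function v) * (- yvar + form_F n) + dy (lyapunov_function v) * (xvar + form_G n)) $ a $ b
      = lyapunov_rhs L $ a $ b"
    using assms(1) by (simp add: is_lyapunov_def)
  then have "- ((dx (lyapunov_function v) * yvar) $ a $ b) + (dx (lyapunov_function v) * form_F n) $ a $ b
      + (dy (lyapunov_function v) * xvar) $ a $ b + (dy (lyapunov_function v) * form_G n) $ a $ b
      = lyapunov_rhs L $ a $ b"
    by (simp only: distrib_left mult_minus_right fps_add_nth fps_neg_nth add.assoc)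
  then show ?thesis
    unfolding form_F_def form_G_def form_nth[OF fin] x y dx dy lyapunov_rhs_nth[OF assms(2)]
    by (auto simp: algebra_simps)
qed

section \<open>Propagation of ideal membership through the degrees\<close>

lemma lyapunov_in_ideal_step:
  assumes lyap: "is_lyapunov n v L" and n: "n \<ge> 2" and I: "ideal I (param_ring n)"
    and k: "k \<ge> 3" "k \<noteq> n + 1"
    and IH: "\<And>i j. i + j < k \<Longrightarrow> i + j \<noteq> 2 \<Longrightarrow> v i j \<in> I"
  shows "(\<forall>i j. i + j = k \<longrightarrow> v i j \<in> I) \<and> (even k \<longrightarrow> L (k div 2 - 1) \<in> I)"
proof -
  let ?s = "\<lambda>c p. rconst c * p"
  interpret V: vector_space ?s by (rule vector_space_rconst)
  have sub: "V.subspace I" by (rule subspace_ideal[OF I])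
  have pvar: "pvar z * p \<in> I" if "z \<in> params n" "p \<in> I" for z p
    using ideal.I_l_closed[OF I that(2) pvar_in_carrier[OF that(1)]] by (simp add: param_ring_def)
  have nat: "of_nat r * p \<in> I" if "p \<in> I" for r p
    using V.subspace_scale[OF sub that, of "of_nat r"] by (simp only: rconst_of_nat)
  \<comment> \<open>The coefficient of \<open>x^i y^(k-i)\<close> in
    \<open>(x^2 + y^2)^(k/2)\<close>; all are 0 for odd \<open>k\<close>, where the right-hand side
    has no terms.\<close>
  define c where "c i = (if even k \<and> even i then real ((k div 2) choose (i div 2)) else 0)" for i
  define l where "l = L (k div 2 - 1)"
  define w where "w i = v i (k - i)" for i
  have eq: "(if i = 0 then 0 else ?s (real (k - i + 1)) (w (i - 1)))
      - (if i = k then 0 else ?s (real (i + 1)) (w (i + 1))) - ?s (c i) l \<in> I" (is "?lhs \<in> I")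
    if "i \<le> k" for i
  proof -
    define EF where "EF = (\<Sum>(i', j) \<in> {(i, j). i + j = n}. if i' \<le> i \<and> j \<le> k - i
        then pvar (PF i' j) * (of_nat (i - i' + 1) * v (i - i' + 1) (k - i - j)) else 0)"
    define EG where "EG = (\<Sum>(i', j) \<in> {(i, j). i + j = n}. if i' \<le> i \<and> j \<le> k - i
        then pvar (PG i' j) * (of_nat (k - i - j + 1) * v (i - i') (k - i - j + 1)) else 0)"
    have "EF \<in> I" unfolding EF_def
    proof (rule V.subspace_sum[OF sub], clarify, goal_cases)
      case (1 a b)
      \<comment> \<open>This coefficient has degree \<open>k + 1 - n\<close>, which is below
        \<open>k\<close> because \<open>n \<ge> 2\<close> and differs from 2 because
        \<open>k \<noteq> n + 1\<close>.\<close>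
      have "v (i - a + 1) (k - i - b) \<in> I" if "a \<le> i" "b \<le> k - i"
        by (rule IH) (use 1 that \<open>i \<le> k\<close> k n in auto)
      then show ?case using 1 by (auto intro!: pvar nat simp: params_def V.subspace_0[OF sub]
            simp del: of_nat_add of_nat_Suc)
    qed
    moreover have "EG \<in> I" unfolding EG_def
    proof (rule V.subspace_sum[OF sub], clarify, goal_cases)
      case (1 a b)
      have "v (i - a) (k - i - b + 1) \<in> I" if "a \<le> i" "b \<le> k - i"
        by (rule IH) (use 1 that \<open>i \<le> k\<close> k n in auto)
      then show ?case using 1 by (auto intro!: pvar nat simp: params_def V.subspace_0[OF sub]
            simp del: of_nat_add of_nat_Suc)
    qed
    ultimately have "- (EF + EG) \<in> I"
      using sub by (blast intro: V.subspace_add V.subspace_neg)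
    moreover have "?lhs = - (EF + EG)"
    proof -
      have "(if even i \<and> even (k - i) then of_nat ((k div 2) choose (i div 2)) * L (k div 2 - 1) else 0)
          = ?s (c i) l"
        using that by (auto simp: c_def l_def rconst_of_nat simp flip: rconst_def)
      moreover have "k - (i - 1) = k - i + 1" if "i \<noteq> 0" using that \<open>i \<le> k\<close> by simp
      moreover have "k - (i + 1) = k - i - 1" by simp
      ultimately show ?thesis
        using lyapunov_formula_nth[OF lyap, of i "k - i"] that k
        unfolding EF_def[symmetric] EG_def[symmetric]
        by (auto simp: rconst_of_nat w_def algebra_simps simp del: of_nat_add of_nat_Suc)
    qed
    ultimately show ?thesis by simp
  qed
  have v_eq_w: "v i j = w i" "i \<le> k" if "i + j = k" for i j
    using that by (auto simp: w_def)
  note rot = vector_space_rconst sub eq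
  show ?thesis
  proof (cases "even k")
    case True
    have c: "c 0 > 0" "c i \<ge> 0" "odd i \<Longrightarrow> c i = 0" for i
      using True by (simp_all add: c_def)
    have "\<exists>p \<le> k. even p \<and> w p = 0"
    proof -
      \<comment> \<open>Both normalizations, for \<open>k = 4 * m\<close> and
        \<open>k = 4 * m + 2\<close>, concern the exponent \<open>2 * m\<close> of
        \<open>x\<close>.\<close>
      define m where "m = k div 4"
      have m: "k - 2 * m = 2 * m \<or> k - 2 * m = 2 * m + 2" "m \<ge> 1" "2 * m \<le> k"
        using True k(1) unfolding m_def by presburger+
      then have "w (2 * m) = 0"
        using lyap unfolding is_lyapunov_def w_def by metis
      then show ?thesis using m(3) by (intro exI[of _ "2 * m"]) simp
    qed
    then obtain p where "p \<le> k" "even p" "w p \<in> I" using V.subspace_0[OF sub] by metis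
    then have "w i \<in> I" if "i \<le> k" for i
      using rotation_even_degree[OF rot, of p i] True k(1) c that by auto
    moreover have "l \<in> I" using rotation_even_degree_const[OF rot] True k(1) c by auto
    ultimately show ?thesis by (simp add: v_eq_w l_def)
  next
    case False
    then have "w i \<in> I" if "i \<le> k" for i
      using rotation_odd_degree[OF rot, of i] that by (simp add: c_def)
    then show ?thesis using False by (simp add: v_eq_w)
  qed
qed

lemma lyapunov_constants_in_ideal:
  assumes lyap: "is_lyapunov n v L" and n: "n \<ge> 2" and I: "ideal I (param_ring n)"
    and V: "V_coeffs (n + 1) v \<subseteq> I" and L: "odd n \<Longrightarrow> L ((n - 1) div 2) \<in> I" and "j \<ge> 1"
  shows "L j \<in> I"
proof -
  have v0: "v i j = 0" if "i + j < 2" for i j using lyap that by (simp add: is_lyapunov_def)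
  have zero: "0 \<in> I"
    using additive_subgroup.zero_closed[OF ideal.axioms(1)[OF I]]
    by (simp add: param_ring_def)
  \<comment> \<open>Degree 2 is left out: \<open>V\<^sub>2\<close> contains the unit
    \<open>1/2\<close>, which lies in no proper ideal.\<close>
  have v: "v i j \<in> I" if "i + j = k" "k \<noteq> 2" for i j k
    using that
  proof (induction k arbitrary: i j rule: less_induct)
    case (less k)
    consider "k < 2" | "k = n + 1" | "k \<ge> 3" "k \<noteq> n + 1" using less.prems by linarith
    then show ?case
    proof cases
      case 1 then show ?thesis using v0 less.prems zero by simp
    next
      case 2 then show ?thesis using V less.prems by (auto simp: V_coeffs_def)
    next
      case 3
      then show ?thesis using lyapunov_in_ideal_step[OF lyap n I 3] less by blast
    qed
  qed
  show ?thesis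
  \<comment> \<open>\<open>L j\<close> occurs in degree \<open>2 * j + 2\<close>, so the degree
    \<open>n + 1\<close> missed by the step lemma concerns exactly
    \<open>j = (n - 1) / 2\<close>.\<close>
  proof (cases "2 * j + 2 = n + 1")
    case True
    then have "odd n" "j = (n - 1) div 2" by presburger+
    then show ?thesis using L by simp
  next
    case False
    then show ?thesis
      using lyapunov_in_ideal_step[OF lyap n I, of "2 * j + 2"] v \<open>j \<ge> 1\<close> by auto
  qed
qed

text \<open>Both conclusions are the same membership statement, once for the ideal generated by
  \<open>C\<close> and once for the kernel of evaluation at a common zero of \<open>C\<close>.
  Leaving \<open>C\<close> general covers both parities of \<open>n\<close>.\<close>

lemma bautin_ideal_subset_and_center_condition:
  assumes lyap: "is_lyapunov n v L" and n: "n \<ge> 2"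
    and C: "finite C" "C \<subseteq> carrier (param_ring n)" "V_coeffs (n + 1) v \<subseteq> C"
    and L: "odd n \<Longrightarrow> L ((n - 1) div 2) \<in> C"
  shows "bautin_ideal n L \<subseteq> Idl\<^bsub>param_ring n\<^esub> C \<and> center_condition n L C"
proof
  interpret cring "param_ring n" by (rule cring_param_ring)
  have in_ideal: "L j \<in> I" if "ideal I (param_ring n)" "C \<subseteq> I" "j \<ge> 1" for I j
    using lyapunov_constants_in_ideal[OF lyap n that(1) _ _ that(3)] C(3) L that(2) by blast
  show "bautin_ideal n L \<subseteq> Idl\<^bsub>param_ring n\<^esub> C"
    unfolding bautin_ideal_def
    by (rule genideal_minimal)
      (use in_ideal genideal_ideal[OF C(2)] genideal_self[OF C(2)] in auto)
  have "param_eval a (L j) = 0" if "\<forall>p \<in> C. param_eval a p = 0" "j \<ge> 1" for a j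
    using in_ideal[OF ideal_param_eval_kernel, of a j] that C(2) by blast
  then show "center_condition n L C" using C(1,2) by (simp add: center_condition_def)
qed

theorem theorem1:
  fixes n :: nat
    and v :: "nat \<Rightarrow> nat \<Rightarrow> param_poly"
    and L :: "nat \<Rightarrow> param_poly"
  assumes "n \<ge> 2"
    and "is_lyapunov n v L"
  shows "(even n \<longrightarrow>
            bautin_ideal n L \<subseteq> Idl\<^bsub>param_ring n\<^esub> (V_coeffs (n + 1) v) \<and>
            center_condition n L (V_coeffs (n + 1) v)) \<and>
         (odd n \<longrightarrow>
            bautin_ideal n L \<subseteq> Idl\<^bsub>param_ring n\<^esub> (insert (L ((n - 1) div 2)) (V_coeffs (n + 1) v)) \<and>
            center_condition n L (insert (L ((n - 1) div 2)) (V_coeffs (n + 1) v)))"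
proof -
  let ?V = "V_coeffs (n + 1) v"
  have "?V \<subseteq> (\<lambda>(i, j). v i j) ` ({..n + 1} \<times> {..n + 1})"
    by (force simp: V_coeffs_def)
  then have fin: "finite ?V" by (rule finite_subset) simp
  have V: "?V \<subseteq> carrier (param_ring n)"
    using assms(2) by (auto simp: V_coeffs_def is_lyapunov_def)
  have L: "L ((n - 1) div 2) \<in> carrier (param_ring n)" if "odd n"
  proof -
    \<comment> \<open>An odd \<open>n \<ge> 2\<close> is at least 3; \<open>is_lyapunov\<close>
      places \<open>L j\<close> in the ring only for \<open>j \<ge> 1\<close>.\<close>
    have "(n - 1) div 2 \<ge> 1" using that assms(1) by presburger
    then show ?thesis using assms(2) by (simp add: is_lyapunov_def)
  qed
  show ?thesis
    using bautin_ideal_subset_and_center_condition[OF assms(2,1), of ?V]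
      bautin_ideal_subset_and_center_condition[OF assms(2,1), of "insert (L ((n - 1) div 2)) ?V"]
      fin V L by blast
qed

end
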